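(* Let $(L,\Delta,\delta_L,\alpha)$ be a Hom-AssCoDer pair and let $T:L\to L$ be an endomorphism operator, i.e. a linear map with $\Delta\circ T=(T\otimes T)\circ\Delta$ and $T\circ\alpha=\alpha\circ T$. Suppose that $T^2=T$ and $T\circ\delta_L=\delta_L\circ T$. Define $$\Delta_c=(1\otimes T)\circ\Delta-(T\otimes 1)\circ\tau\circ\Delta.$$ Then $(L,\Delta_c,\delta_L,\alpha)$ is a Hom-Lie CoDer pair.
   Context: All vector spaces and tensor products are over a field $\mathbb{K}$ of characteristic $0$. Let $\tau(x\otimes y)=y\otimes x$ and $\xi(x\otimes y\otimes z)=y\otimes z\otimes x$. A Hom-AssCoDer pair $(L,\Delta,\delta_L,\alpha)$ is a vector space $L$ with linear maps $\Delta:L\to L\otimes L$, $\alpha,\delta_L:L\to L$ such that $(\alpha\otimes\Delta)\circ\Delta=(\Delta\otimes\alpha)\circ\Delta$ and $\Delta\circ\delta_L=(\delta_L\otimes\alpha)\circ\Delta+(\alpha\otimes\delta_L)\circ\Delta$. A Hom-Lie CoDer pair $(L,\Delta',\varphi,\alpha)$ is a vector space $L$ with linear maps $\Delta':L\to L\otimes L$, $\alpha,\varphi:L\to L$ such that $\Delta'=-\tau\circ\Delta'$, $(1+\xi+\xi^2)\circ(\alpha\otimes\Delta')\circ\Delta'=0$ and $\Delta'\circ\varphi=(\varphi\otimes\alpha)\circ\Delta'+(\alpha\otimes\varphi)\circ\Delta'$. *)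

theory Defs
  imports Complex_Main "HOL-Library.Poly_Mapping"
begin

section \<open>Tensor products of vector spaces\<close>

text \<open>
  A vector space over a field \<open>'k\<close> is a type \<open>'v :: ab_group_add\<close> with a scalar multiplication
  satisfying \<^locale>\<open>vector_space\<close>.  Since a type cannot depend on the scalar multiplication, the
  tensor product is not a type constructor; instead \<open>is_tensor_product sU sV sW t\<close> says that the
  space \<open>'w\<close>, with \<open>t u v\<close> in the role of \<open>u \<otimes> v\<close>, is a realization of \<open>U \<otimes> V\<close>: the map
  \<open>(u, v) \<mapsto> t u v\<close> induces an isomorphism onto \<open>'w\<close> from the free vector space on \<open>U \<times> V\<close> modulo
  the bilinearity relations.
\<close>

definition free_scale :: "'k::field \<Rightarrow> ('a \<Rightarrow>\<^sub>0 'k) \<Rightarrow> ('a \<Rightarrow>\<^sub>0 'k)" where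
  "free_scale c p = Poly_Mapping.map ((*) c) p"

definition free_extend ::
  "('k::field \<Rightarrow> 'w::ab_group_add \<Rightarrow> 'w) \<Rightarrow> ('a \<Rightarrow> 'w) \<Rightarrow> ('a \<Rightarrow>\<^sub>0 'k) \<Rightarrow> 'w" where
  "free_extend sW g p = (\<Sum>x\<in>Poly_Mapping.keys p. sW (Poly_Mapping.lookup p x) (g x))"

inductive_set tensor_relations ::
  "('k::field \<Rightarrow> 'u::ab_group_add \<Rightarrow> 'u) \<Rightarrow> ('k \<Rightarrow> 'v::ab_group_add \<Rightarrow> 'v)
    \<Rightarrow> ('u \<times> 'v \<Rightarrow>\<^sub>0 'k) set"
  for sU sV where
  add_left: "Poly_Mapping.single (u + u', v) 1 - Poly_Mapping.single (u, v) 1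
      - Poly_Mapping.single (u', v) 1 \<in> tensor_relations sU sV"
| add_right: "Poly_Mapping.single (u, v + v') 1 - Poly_Mapping.single (u, v) 1
      - Poly_Mapping.single (u, v') 1 \<in> tensor_relations sU sV"
| scale_left: "Poly_Mapping.single (sU c u, v) 1 - Poly_Mapping.single (u, v) c
      \<in> tensor_relations sU sV"
| scale_right: "Poly_Mapping.single (u, sV c v) 1 - Poly_Mapping.single (u, v) c
      \<in> tensor_relations sU sV"

definition is_tensor_product ::
  "('k::field \<Rightarrow> 'u::ab_group_add \<Rightarrow> 'u) \<Rightarrow> ('k \<Rightarrow> 'v::ab_group_add \<Rightarrow> 'v)
    \<Rightarrow> ('k \<Rightarrow> 'w::ab_group_add \<Rightarrow> 'w) \<Rightarrow> ('u \<Rightarrow> 'v \<Rightarrow> 'w) \<Rightarrow> bool" where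
  "is_tensor_product sU sV sW t \<longleftrightarrow>
     vector_space sU \<and> vector_space sV \<and> vector_space sW \<and>
     surj (free_extend sW (case_prod t)) \<and>
     {p. free_extend sW (case_prod t) p = 0} = module.span free_scale (tensor_relations sU sV)"

definition bilinear_map ::
  "('k::field \<Rightarrow> 'u::ab_group_add \<Rightarrow> 'u) \<Rightarrow> ('k \<Rightarrow> 'v::ab_group_add \<Rightarrow> 'v)
    \<Rightarrow> ('k \<Rightarrow> 'x::ab_group_add \<Rightarrow> 'x) \<Rightarrow> ('u \<Rightarrow> 'v \<Rightarrow> 'x) \<Rightarrow> bool" where
  "bilinear_map sU sV sX f \<longleftrightarrow>
     (\<forall>u. Vector_Spaces.linear sV sX (f u)) \<and> (\<forall>v. Vector_Spaces.linear sU sX (\<lambda>u. f u v))"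

lemma lookup_free_scale [simp]:
  "Poly_Mapping.lookup (free_scale c p) x = c * Poly_Mapping.lookup p x"
  by (simp add: free_scale_def Poly_Mapping.map.rep_eq when_def)

lemma vector_space_free: "vector_space (free_scale :: 'k::field \<Rightarrow> _ \<Rightarrow> ('a \<Rightarrow>\<^sub>0 'k))"
  by unfold_locales (auto intro!: poly_mapping_eqI simp: lookup_add algebra_simps)

lemma free_extend_superset:
  assumes "vector_space sW" "finite A" "Poly_Mapping.keys p \<subseteq> A"
  shows "free_extend sW g p = (\<Sum>x\<in>A. sW (Poly_Mapping.lookup p x) (g x))"
proof -
  interpret vector_space sW by fact
  show ?thesis
    unfolding free_extend_def
    by (rule sum.mono_neutral_left) (use assms in \<open>auto simp: in_keys_iff\<close>)
qed

lemma linear_free_extend: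
  assumes W: "vector_space sW"
  shows "Vector_Spaces.linear free_scale sW (free_extend sW g)"
proof -
  interpret vector_space sW by fact
  have "free_extend sW g (p + q) = free_extend sW g p + free_extend sW g q" for p q
  proof -
    let ?A = "Poly_Mapping.keys p \<union> Poly_Mapping.keys q"
    show ?thesis
      using free_extend_superset[OF W, of ?A "p + q" g] free_extend_superset[OF W, of ?A p g]
        free_extend_superset[OF W, of ?A q g] Poly_Mapping.keys_add[of p q]
      by (auto simp: lookup_add scale_left_distrib sum.distrib)
  qed
  moreover have "free_extend sW g (free_scale c p) = sW c (free_extend sW g p)" for c p
  proof -
    have "Poly_Mapping.keys (free_scale c p) \<subseteq> Poly_Mapping.keys p"
      by (auto simp: in_keys_iff)
    then show ?thesis
      using free_extend_superset[OF W, of "Poly_Mapping.keys p" "free_scale c p" g]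
        free_extend_superset[OF W, of "Poly_Mapping.keys p" p g]
      by (simp add: scale_sum_right)
  qed
  ultimately show ?thesis
    unfolding Vector_Spaces.linear_iff using W vector_space_free by blast
qed

lemma free_extend_single:
  assumes W: "vector_space sW"
  shows "free_extend sW g (Poly_Mapping.single x c) = sW c (g x)"
proof -
  interpret vector_space sW by fact
  show ?thesis by (simp add: free_extend_def)
qed

lemma free_extend_comp:
  assumes h: "Vector_Spaces.linear sW sX h"
  shows "h (free_extend sW g p) = free_extend sX (\<lambda>x. h (g x)) p"
proof -
  interpret Vector_Spaces.linear sW sX h by fact
  show ?thesis by (simp add: free_extend_def sum scale)
qed

lemma is_tensor_product_bilinear:
  assumes t: "is_tensor_product sU sV sW t"
  shows "bilinear_map sU sV sW t"
proof -
  have vs: "vector_space sU" "vector_space sV" and W: "vector_space sW"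
    and ker: "{p. free_extend sW (case_prod t) p = 0}
      = module.span free_scale (tensor_relations sU sV)"
    using t by (auto simp: is_tensor_product_def)
  interpret W: vector_space sW by fact
  interpret F: vector_space "free_scale :: 'a \<Rightarrow> ('b \<times> 'c \<Rightarrow>\<^sub>0 'a) \<Rightarrow> _" by (rule vector_space_free)
  interpret e: Vector_Spaces.linear free_scale sW "free_extend sW (case_prod t)"
    by (rule linear_free_extend[OF W])
  have z: "free_extend sW (case_prod t) r = 0" if "r \<in> tensor_relations sU sV" for r
    using F.span_base[OF that] ker by auto
  note [simp] = e.add e.diff free_extend_single[OF W]
  have "t (u + u') v = t u v + t u' v" for u u' v
    using z[OF add_left[of u u' v]] by (simp add: algebra_simps)
  moreover have "t u (v + v') = t u v + t u v'" for u v v'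
    using z[OF add_right[of u v v']] by (simp add: algebra_simps)
  moreover have "t (sU c u) v = sW c (t u v)" for c u v
    using z[OF scale_left[of sU c u v]] by simp
  moreover have "t u (sV c v) = sW c (t u v)" for c u v
    using z[OF scale_right[of u sV c v]] by simp
  ultimately show ?thesis
    using vs W by (auto simp: bilinear_map_def Vector_Spaces.linear_iff)
qed

text \<open>The universal property, for an arbitrary target space.\<close>

lemma tensor_product_universal:
  assumes t: "is_tensor_product sU sV sW t" and f: "bilinear_map sU sV sX f"
  shows "\<exists>!h. Vector_Spaces.linear sW sX h \<and> (\<forall>u v. h (t u v) = f u v)"
proof -
  have W: "vector_space sW" and sur: "surj (free_extend sW (case_prod t))"
    and ker: "{p. free_extend sW (case_prod t) p = 0}
      = module.span free_scale (tensor_relations sU sV)"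
    using t by (auto simp: is_tensor_product_def)
  have X: "vector_space sX"
    using f by (auto simp: bilinear_map_def Vector_Spaces.linear_iff)
  interpret W: vector_space sW by fact
  interpret X: vector_space sX by fact
  interpret F: vector_space "free_scale :: 'a \<Rightarrow> ('b \<times> 'c \<Rightarrow>\<^sub>0 'a) \<Rightarrow> _" by (rule vector_space_free)
  define e where "e = free_extend sW (case_prod t)"
  define k where "k = free_extend sX (case_prod f)"
  interpret e: Vector_Spaces.linear free_scale sW e
    unfolding e_def by (rule linear_free_extend[OF W])
  interpret k: Vector_Spaces.linear free_scale sX k
    unfolding k_def by (rule linear_free_extend[OF X])
  have k_single: "k (Poly_Mapping.single (u, v) c) = sX c (f u v)" for u v c
    by (simp add: k_def free_extend_single[OF X])
  have k_rel: "k r = 0" if "r \<in> tensor_relations sU sV" for r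
    using that f
    by cases (auto simp: k.diff k_single bilinear_map_def Vector_Spaces.linear_iff)
  have k_ker: "k p = 0" if "e p = 0" for p
  proof -
    have "p \<in> F.span (tensor_relations sU sV)" using that ker by (auto simp: e_def)
    then show ?thesis using k.eq_0_on_span[of "tensor_relations sU sV" p] k_rel by blast
  qed
  have k_eq: "k p = k q" if "e p = e q" for p q
    using k_ker[of "p - q"] that by (simp add: e.diff k.diff)
  define h where "h w = k (inv e w)" for w
  have eh: "e (inv e w) = w" for w
    using sur by (simp add: e_def surj_f_inv_f)
  have he: "h (e p) = k p" for p
    unfolding h_def by (rule k_eq) (rule eh)
  have "h (w + w') = h w + h w'" for w w'
    using he[of "inv e w + inv e w'"] by (simp add: e.add k.add eh h_def)
  moreover have "h (sW c w) = sX c (h w)" for c w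
    using he[of "free_scale c (inv e w)"] by (simp add: e.scale k.scale eh h_def)
  ultimately have lin: "Vector_Spaces.linear sW sX h"
    using W X by (auto simp: Vector_Spaces.linear_iff)
  have ht: "h (t u v) = f u v" for u v
    using he[of "Poly_Mapping.single (u, v) 1"]
    by (simp add: k_single) (simp add: e_def free_extend_single[OF W])
  show ?thesis
  proof (rule ex1I[of _ h])
    show "Vector_Spaces.linear sW sX h \<and> (\<forall>u v. h (t u v) = f u v)" using lin ht by blast
    fix g assume g: "Vector_Spaces.linear sW sX g \<and> (\<forall>u v. g (t u v) = f u v)"
    show "g = h"
    proof
      fix w
      have "g (e p) = h (e p)" for p
        using g ht lin free_extend_comp[of sW sX g "case_prod t" p]
          free_extend_comp[of sW sX h "case_prod t" p] unfolding e_def by (simp add: split_def)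
      then show "g w = h w" using eh[of w] by metis
    qed
  qed
qed

text \<open>The linear map determined by prescribing it bilinearly on pure tensors.\<close>

definition tensor_lift ::
  "('k::field \<Rightarrow> 'w::ab_group_add \<Rightarrow> 'w) \<Rightarrow> ('k \<Rightarrow> 'x::ab_group_add \<Rightarrow> 'x)
    \<Rightarrow> ('u \<Rightarrow> 'v \<Rightarrow> 'w) \<Rightarrow> ('u \<Rightarrow> 'v \<Rightarrow> 'x) \<Rightarrow> 'w \<Rightarrow> 'x" where
  "tensor_lift sW sX t f = (THE h. Vector_Spaces.linear sW sX h \<and> (\<forall>u v. h (t u v) = f u v))"

lemma tensor_lift:
  assumes "is_tensor_product sU sV sW t" "bilinear_map sU sV sX f"
  shows "Vector_Spaces.linear sW sX (tensor_lift sW sX t f)"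
    and "tensor_lift sW sX t f (t u v) = f u v"
  using theI'[OF tensor_product_universal[OF assms]] by (auto simp: tensor_lift_def)


section \<open>The spaces L, L \<open>\<otimes>\<close> L and L \<open>\<otimes>\<close> L \<open>\<otimes>\<close> L\<close>

text \<open>
  \<open>tens x y\<close> is \<open>x \<otimes> y\<close>.  Both bracketings of the triple tensor product are realized on the same
  space, via \<open>tens_r x w = x \<otimes> w\<close> and \<open>tens_l w z = w \<otimes> z\<close> for \<open>w\<close> in \<open>L \<otimes> L\<close>; the last condition
  of \<open>tensor_powers\<close> is the usual identification \<open>x \<otimes> (y \<otimes> z) = (x \<otimes> y) \<otimes> z\<close>.
\<close>

record ('k, 'l, 'l2, 'l3) tensor_space =
  scale1 :: "'k \<Rightarrow> 'l \<Rightarrow> 'l"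
  scale2 :: "'k \<Rightarrow> 'l2 \<Rightarrow> 'l2"
  scale3 :: "'k \<Rightarrow> 'l3 \<Rightarrow> 'l3"
  tens :: "'l \<Rightarrow> 'l \<Rightarrow> 'l2"
  tens_r :: "'l \<Rightarrow> 'l2 \<Rightarrow> 'l3"
  tens_l :: "'l2 \<Rightarrow> 'l \<Rightarrow> 'l3"

definition tensor_powers ::
  "('k::field, 'l::ab_group_add, 'l2::ab_group_add, 'l3::ab_group_add) tensor_space \<Rightarrow> bool" where
  "tensor_powers L \<longleftrightarrow>
     is_tensor_product (scale1 L) (scale1 L) (scale2 L) (tens L) \<and>
     is_tensor_product (scale1 L) (scale2 L) (scale3 L) (tens_r L) \<and>
     is_tensor_product (scale2 L) (scale1 L) (scale3 L) (tens_l L) \<and>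
     (\<forall>x y z. tens_r L x (tens L y z) = tens_l L (tens L x y) z)"

text \<open>
  \<open>f \<otimes> g\<close> for \<open>f, g : L \<rightarrow> L\<close>; for \<open>f : L \<rightarrow> L\<close>, \<open>g : L \<rightarrow> L \<otimes> L\<close>; and for
  \<open>f : L \<rightarrow> L \<otimes> L\<close>, \<open>g : L \<rightarrow> L\<close>.
\<close>

definition tmap ::
  "('k::field, 'l::ab_group_add, 'l2::ab_group_add, 'l3::ab_group_add) tensor_space
    \<Rightarrow> ('l \<Rightarrow> 'l) \<Rightarrow> ('l \<Rightarrow> 'l) \<Rightarrow> 'l2 \<Rightarrow> 'l2" where
  "tmap L f g = tensor_lift (scale2 L) (scale2 L) (tens L) (\<lambda>x y. tens L (f x) (g y))"

definition tmap_r ::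
  "('k::field, 'l::ab_group_add, 'l2::ab_group_add, 'l3::ab_group_add) tensor_space
    \<Rightarrow> ('l \<Rightarrow> 'l) \<Rightarrow> ('l \<Rightarrow> 'l2) \<Rightarrow> 'l2 \<Rightarrow> 'l3" where
  "tmap_r L f g = tensor_lift (scale2 L) (scale3 L) (tens L) (\<lambda>x y. tens_r L (f x) (g y))"

definition tmap_l ::
  "('k::field, 'l::ab_group_add, 'l2::ab_group_add, 'l3::ab_group_add) tensor_space
    \<Rightarrow> ('l \<Rightarrow> 'l2) \<Rightarrow> ('l \<Rightarrow> 'l) \<Rightarrow> 'l2 \<Rightarrow> 'l3" where
  "tmap_l L f g = tensor_lift (scale2 L) (scale3 L) (tens L) (\<lambda>x y. tens_l L (f x) (g y))"

definition swap_map ::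
  "('k::field, 'l::ab_group_add, 'l2::ab_group_add, 'l3::ab_group_add) tensor_space
    \<Rightarrow> 'l2 \<Rightarrow> 'l2" where
  "swap_map L = tensor_lift (scale2 L) (scale2 L) (tens L) (\<lambda>x y. tens L y x)"

definition cycle_map ::
  "('k::field, 'l::ab_group_add, 'l2::ab_group_add, 'l3::ab_group_add) tensor_space
    \<Rightarrow> 'l3 \<Rightarrow> 'l3" where
  "cycle_map L = (THE h. Vector_Spaces.linear (scale3 L) (scale3 L) h \<and>
     (\<forall>x y z. h (tens_r L x (tens L y z)) = tens_r L y (tens L z x)))"

lemma bilinear_map_tens_maps:
  assumes t: "is_tensor_product sU sV sW t"
    and f: "Vector_Spaces.linear sA sU f" and g: "Vector_Spaces.linear sB sV g"
  shows "bilinear_map sA sB sW (\<lambda>a b. t (f a) (g b))"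
  using is_tensor_product_bilinear[OF t] f g
  by (auto simp: bilinear_map_def Vector_Spaces.linear_iff)

lemma tmap:
  assumes "tensor_powers L" "Vector_Spaces.linear (scale1 L) (scale1 L) f"
    "Vector_Spaces.linear (scale1 L) (scale1 L) g"
  shows "Vector_Spaces.linear (scale2 L) (scale2 L) (tmap L f g)"
    and "tmap L f g (tens L x y) = tens L (f x) (g y)"
proof -
  have "is_tensor_product (scale1 L) (scale1 L) (scale2 L) (tens L)"
    using assms(1) by (simp add: tensor_powers_def)
  from tensor_lift[OF this bilinear_map_tens_maps[OF this assms(2,3)]]
  show "Vector_Spaces.linear (scale2 L) (scale2 L) (tmap L f g)"
    and "tmap L f g (tens L x y) = tens L (f x) (g y)"
    by (simp_all add: tmap_def)
qed

lemma tmap_r: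
  assumes "tensor_powers L" "Vector_Spaces.linear (scale1 L) (scale1 L) f"
    "Vector_Spaces.linear (scale1 L) (scale2 L) g"
  shows "Vector_Spaces.linear (scale2 L) (scale3 L) (tmap_r L f g)"
    and "tmap_r L f g (tens L x y) = tens_r L (f x) (g y)"
proof -
  have t: "is_tensor_product (scale1 L) (scale1 L) (scale2 L) (tens L)"
    and t': "is_tensor_product (scale1 L) (scale2 L) (scale3 L) (tens_r L)"
    using assms(1) by (simp_all add: tensor_powers_def)
  from tensor_lift[OF t bilinear_map_tens_maps[OF t' assms(2,3)]]
  show "Vector_Spaces.linear (scale2 L) (scale3 L) (tmap_r L f g)"
    and "tmap_r L f g (tens L x y) = tens_r L (f x) (g y)"
    by (simp_all add: tmap_r_def)
qed

lemma tmap_l: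
  assumes "tensor_powers L" "Vector_Spaces.linear (scale1 L) (scale2 L) f"
    "Vector_Spaces.linear (scale1 L) (scale1 L) g"
  shows "Vector_Spaces.linear (scale2 L) (scale3 L) (tmap_l L f g)"
    and "tmap_l L f g (tens L x y) = tens_l L (f x) (g y)"
proof -
  have t: "is_tensor_product (scale1 L) (scale1 L) (scale2 L) (tens L)"
    and t': "is_tensor_product (scale2 L) (scale1 L) (scale3 L) (tens_l L)"
    using assms(1) by (simp_all add: tensor_powers_def)
  from tensor_lift[OF t bilinear_map_tens_maps[OF t' assms(2,3)]]
  show "Vector_Spaces.linear (scale2 L) (scale3 L) (tmap_l L f g)"
    and "tmap_l L f g (tens L x y) = tens_l L (f x) (g y)"
    by (simp_all add: tmap_l_def)
qed

lemma swap_map: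
  assumes "tensor_powers L"
  shows "Vector_Spaces.linear (scale2 L) (scale2 L) (swap_map L)"
    and "swap_map L (tens L x y) = tens L y x"
proof -
  have t: "is_tensor_product (scale1 L) (scale1 L) (scale2 L) (tens L)"
    using assms by (simp add: tensor_powers_def)
  then have b: "bilinear_map (scale1 L) (scale1 L) (scale2 L) (\<lambda>x y. tens L y x)"
    using is_tensor_product_bilinear[OF t] by (auto simp: bilinear_map_def)
  from tensor_lift[OF t b]
  show "Vector_Spaces.linear (scale2 L) (scale2 L) (swap_map L)"
    and "swap_map L (tens L x y) = tens L y x"
    by (simp_all add: swap_map_def)
qed

lemma tensor_linear_eqI:
  assumes t: "is_tensor_product sU sV sW t"
    and f: "Vector_Spaces.linear sW sX f" and g: "Vector_Spaces.linear sW sX g"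
    and eq: "\<And>u v. f (t u v) = g (t u v)"
  shows "f = g"
proof -
  have "bilinear_map sU sV sX (\<lambda>u v. g (t u v))"
    using is_tensor_product_bilinear[OF t] g
    by (auto simp: bilinear_map_def Vector_Spaces.linear_iff)
  from tensor_product_universal[OF t this] show ?thesis using f g eq by blast
qed

lemma cycle_map:
  fixes L :: "('k::field, 'l::ab_group_add, 'l2::ab_group_add, 'l3::ab_group_add) tensor_space"
  assumes L: "tensor_powers L"
  shows "Vector_Spaces.linear (scale3 L) (scale3 L) (cycle_map L)"
    and "cycle_map L (tens_r L x (tens L y z)) = tens_r L y (tens L z x)"
proof -
  have t: "is_tensor_product (scale1 L) (scale1 L) (scale2 L) (tens L)"
    and tr: "is_tensor_product (scale1 L) (scale2 L) (scale3 L) (tens_r L)"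
    and tl: "is_tensor_product (scale2 L) (scale1 L) (scale3 L) (tens_l L)"
    and assoc: "tens_r L x (tens L y z) = tens_l L (tens L x y) z" for x y z
    using L by (auto simp: tensor_powers_def)
  let ?P = "\<lambda>h. Vector_Spaces.linear (scale3 L) (scale3 L) h \<and>
     (\<forall>x y z. h (tens_r L x (tens L y z)) = tens_r L y (tens L z x))"
  define h where "h = tensor_lift (scale3 L) (scale3 L) (tens_r L) (\<lambda>x w. tens_l L w x)"
  have b: "bilinear_map (scale1 L) (scale2 L) (scale3 L) (\<lambda>x w. tens_l L w x)"
    using is_tensor_product_bilinear[OF tl] by (auto simp: bilinear_map_def)
  have h: "?P h"
    using tensor_lift[OF tr b] by (auto simp: h_def assoc[symmetric])
  moreover have "g = h" if g: "?P g" for g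
  proof (rule tensor_linear_eqI[OF tr])
    show gl: "Vector_Spaces.linear (scale3 L) (scale3 L) g" using g by blast
    show hl: "Vector_Spaces.linear (scale3 L) (scale3 L) h" using h by blast
    fix x w
    have r: "Vector_Spaces.linear (scale2 L) (scale3 L) (tens_r L x)"
      using is_tensor_product_bilinear[OF tr] by (simp add: bilinear_map_def)
    have "(\<lambda>w. g (tens_r L x w)) = (\<lambda>w. h (tens_r L x w))"
      by (rule tensor_linear_eqI[OF t])
        (use r gl hl g h in \<open>auto simp: Vector_Spaces.linear_iff\<close>)
    then show "g (tens_r L x w) = h (tens_r L x w)" by metis
  qed
  ultimately have "\<exists>!h. ?P h" by blast
  from theI'[OF this]
  show "Vector_Spaces.linear (scale3 L) (scale3 L) (cycle_map L)"
    and "cycle_map L (tens_r L x (tens L y z)) = tens_r L y (tens L z x)"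
    by (auto simp: cycle_map_def)
qed


section \<open>Hom-AssCoDer and Hom-Lie CoDer pairs\<close>

definition hom_coderivation ::
  "('k::field, 'l::ab_group_add, 'l2::ab_group_add, 'l3::ab_group_add) tensor_space
    \<Rightarrow> ('l \<Rightarrow> 'l2) \<Rightarrow> ('l \<Rightarrow> 'l) \<Rightarrow> ('l \<Rightarrow> 'l) \<Rightarrow> bool" where
  "hom_coderivation L \<Delta> \<delta> \<alpha> \<longleftrightarrow>
     (\<forall>x. \<Delta> (\<delta> x) = tmap L \<delta> \<alpha> (\<Delta> x) + tmap L \<alpha> \<delta> (\<Delta> x))"

definition hom_ass_coder_pair ::
  "('k::field, 'l::ab_group_add, 'l2::ab_group_add, 'l3::ab_group_add) tensor_space
    \<Rightarrow> ('l \<Rightarrow> 'l2) \<Rightarrow> ('l \<Rightarrow> 'l) \<Rightarrow> ('l \<Rightarrow> 'l) \<Rightarrow> bool" where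
  "hom_ass_coder_pair L \<Delta> \<delta> \<alpha> \<longleftrightarrow>
     Vector_Spaces.linear (scale1 L) (scale2 L) \<Delta> \<and>
     Vector_Spaces.linear (scale1 L) (scale1 L) \<alpha> \<and>
     Vector_Spaces.linear (scale1 L) (scale1 L) \<delta> \<and>
     tmap_r L \<alpha> \<Delta> \<circ> \<Delta> = tmap_l L \<Delta> \<alpha> \<circ> \<Delta> \<and>
     hom_coderivation L \<Delta> \<delta> \<alpha>"

definition hom_lie_coder_pair ::
  "('k::field, 'l::ab_group_add, 'l2::ab_group_add, 'l3::ab_group_add) tensor_space
    \<Rightarrow> ('l \<Rightarrow> 'l2) \<Rightarrow> ('l \<Rightarrow> 'l) \<Rightarrow> ('l \<Rightarrow> 'l) \<Rightarrow> bool" where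
  "hom_lie_coder_pair L \<Delta> \<phi> \<alpha> \<longleftrightarrow>
     Vector_Spaces.linear (scale1 L) (scale2 L) \<Delta> \<and>
     Vector_Spaces.linear (scale1 L) (scale1 L) \<alpha> \<and>
     Vector_Spaces.linear (scale1 L) (scale1 L) \<phi> \<and>
     (\<forall>x. \<Delta> x = - swap_map L (\<Delta> x)) \<and>
     (\<forall>x. let w = tmap_r L \<alpha> \<Delta> (\<Delta> x)
          in w + cycle_map L w + cycle_map L (cycle_map L w) = 0) \<and>
     hom_coderivation L \<Delta> \<phi> \<alpha>"

definition endomorphism_operator ::
  "('k::field, 'l::ab_group_add, 'l2::ab_group_add, 'l3::ab_group_add) tensor_space
    \<Rightarrow> ('l \<Rightarrow> 'l2) \<Rightarrow> ('l \<Rightarrow> 'l) \<Rightarrow> ('l \<Rightarrow> 'l) \<Rightarrow> bool" where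
  "endomorphism_operator L \<Delta> \<alpha> T \<longleftrightarrow>
     Vector_Spaces.linear (scale1 L) (scale1 L) T \<and>
     \<Delta> \<circ> T = tmap L T T \<circ> \<Delta> \<and> T \<circ> \<alpha> = \<alpha> \<circ> T"

definition commutator_coproduct ::
  "('k::field, 'l::ab_group_add, 'l2::ab_group_add, 'l3::ab_group_add) tensor_space
    \<Rightarrow> ('l \<Rightarrow> 'l2) \<Rightarrow> ('l \<Rightarrow> 'l) \<Rightarrow> 'l \<Rightarrow> 'l2" where
  "commutator_coproduct L \<Delta> T x = tmap L id T (\<Delta> x) - tmap L T id (swap_map L (\<Delta> x))"

end

theory Submission
  imports Defs
begin

text \<open>
  Write \<open>P = (1 \<otimes> T) \<circ> \<Delta>\<close>.  Since \<open>(T \<otimes> 1) \<circ> \<tau> = \<tau> \<circ> (1 \<otimes> T)\<close>, the map \<open>\<Delta>\<^sub>c\<close> is the ordinary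
  cocommutator \<open>P - \<tau> \<circ> P\<close>, and the theorem splits into two facts.

  First, \<open>P\<close> is again the coproduct of a Hom-AssCoDer pair (\<open>hom_ass_coder_pair_twist\<close>).  This is
  dual to the observation that \<open>a \<circ> b = a T(b)\<close> is associative for an idempotent endomorphism \<open>T\<close> of
  an associative algebra, because \<open>a T(b T(c)) = a T(b) T(T(c)) = (a T(b)) T(c)\<close>.  On the level of
  coproducts, both sides of Hom-coassociativity for \<open>P\<close> turn out to be \<open>1 \<otimes> T \<otimes> T\<close> applied to the
  corresponding side for \<open>\<Delta>\<close>.

  Second, the cocommutator of any Hom-AssCoDer pair gives a Hom-Lie CoDer pair
  (\<open>hom_lie_coder_pair_cocommutator\<close>).  With \<open>A = (\<alpha> \<otimes> P) \<circ> P = (P \<otimes> \<alpha>) \<circ> P\<close> and \<open>\<sigma> = 1 \<otimes> \<tau>\<close> one finds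
  \<open>(\<alpha> \<otimes> \<Delta>\<^sub>c) \<circ> \<Delta>\<^sub>c = A - \<sigma> A - \<xi>\<^sup>2 A + \<xi> \<sigma> A\<close>, and the four terms cancel in pairs under
  \<open>1 + \<xi> + \<xi>\<^sup>2\<close> because \<open>\<xi>\<^sup>3 = 1\<close>.

  All identities between maps out of tensor powers are checked on pure tensors.
\<close>

section \<open>Linear maps on tensor powers\<close>

lemma linear_comp:
  "Vector_Spaces.linear sA sB f \<Longrightarrow> Vector_Spaces.linear sB sC g \<Longrightarrow>
    Vector_Spaces.linear sA sC (g \<circ> f)"
  by (auto simp: Vector_Spaces.linear_iff)

lemma linear_minus:
  assumes f: "Vector_Spaces.linear sA sB f" and g: "Vector_Spaces.linear sA sB g"
  shows "Vector_Spaces.linear sA sB (\<lambda>x. f x - g x)"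
proof -
  interpret vector_space sB using f by (simp add: Vector_Spaces.linear_iff)
  show ?thesis
    using f g by (auto simp: Vector_Spaces.linear_iff scale_right_diff_distrib)
qed

lemma linear_apply_diff:
  assumes "Vector_Spaces.linear sA sB f"
  shows "f (x - y) = f x - f y"
proof -
  interpret Vector_Spaces.linear sA sB f by fact
  show ?thesis by (rule diff)
qed

lemma linear_apply_add:
  "Vector_Spaces.linear sA sB f \<Longrightarrow> f (x + y) = f x + f y"
  by (simp add: Vector_Spaces.linear_iff)

text \<open>
  The maps \<open>f \<otimes> g\<close> on the triple tensor product with \<open>f : L \<rightarrow> L\<close> and \<open>g : L \<otimes> L \<rightarrow> L \<otimes> L\<close>; they provide
  both \<open>1 \<otimes> \<tau>\<close> and \<open>1 \<otimes> T \<otimes> T\<close>.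
\<close>

definition tmap3 ::
  "('k::field, 'l::ab_group_add, 'l2::ab_group_add, 'l3::ab_group_add) tensor_space
    \<Rightarrow> ('l \<Rightarrow> 'l) \<Rightarrow> ('l2 \<Rightarrow> 'l2) \<Rightarrow> 'l3 \<Rightarrow> 'l3" where
  "tmap3 L f g = tensor_lift (scale3 L) (scale3 L) (tens_r L) (\<lambda>x w. tens_r L (f x) (g w))"

context
  fixes L :: "('k::field, 'l::ab_group_add, 'l2::ab_group_add, 'l3::ab_group_add) tensor_space"
  assumes L: "tensor_powers L"
begin

abbreviation "lin11 \<equiv> Vector_Spaces.linear (scale1 L) (scale1 L)"
abbreviation "lin12 \<equiv> Vector_Spaces.linear (scale1 L) (scale2 L)"
abbreviation "lin22 \<equiv> Vector_Spaces.linear (scale2 L) (scale2 L)"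
abbreviation "lin23 \<equiv> Vector_Spaces.linear (scale2 L) (scale3 L)"
abbreviation "lin33 \<equiv> Vector_Spaces.linear (scale3 L) (scale3 L)"

lemma tens_product: "is_tensor_product (scale1 L) (scale1 L) (scale2 L) (tens L)"
  and tens_r_product: "is_tensor_product (scale1 L) (scale2 L) (scale3 L) (tens_r L)"
  and tens_l_product: "is_tensor_product (scale2 L) (scale1 L) (scale3 L) (tens_l L)"
  and tens_assoc: "tens_r L x (tens L y z) = tens_l L (tens L x y) z"
  using L by (auto simp: tensor_powers_def)

lemma linear_tens_r: "lin23 (tens_r L x)"
  using is_tensor_product_bilinear[OF tens_r_product] by (simp add: bilinear_map_def)

lemma linear_tens_l: "lin23 (\<lambda>w. tens_l L w z)"
  using is_tensor_product_bilinear[OF tens_l_product] by (simp add: bilinear_map_def)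

lemma linear_id: "lin11 id"
  and linear_id2: "lin22 id"
  and linear_id3: "lin33 id"
  using tens_product tens_r_product
  by (auto simp: is_tensor_product_def Vector_Spaces.linear_iff)

lemmas tens2_eqI = tensor_linear_eqI[OF tens_product]

lemma tens3_eqI:
  assumes f: "Vector_Spaces.linear (scale3 L) sX f" and g: "Vector_Spaces.linear (scale3 L) sX g"
    and eq: "\<And>x y z. f (tens_r L x (tens L y z)) = g (tens_r L x (tens L y z))"
  shows "f = g"
proof (rule tensor_linear_eqI[OF tens_r_product f g])
  fix x w
  have "f \<circ> tens_r L x = g \<circ> tens_r L x"
    by (rule tens2_eqI) (auto intro: linear_comp[OF linear_tens_r f] linear_comp[OF linear_tens_r g]
        simp: eq)
  then show "f (tens_r L x w) = g (tens_r L x w)"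
    by (simp add: fun_eq_iff)
qed

lemma tmap3:
  assumes f: "lin11 f" and g: "lin22 g"
  shows linear_tmap3: "lin33 (tmap3 L f g)"
    and tmap3_tens_r: "tmap3 L f g (tens_r L x w) = tens_r L (f x) (g w)"
  using tensor_lift[OF tens_r_product bilinear_map_tens_maps[OF tens_r_product f g]]
  by (simp_all add: tmap3_def)

lemmas linear_rules = linear_comp linear_id linear_id2 linear_id3 linear_tens_r linear_tens_l
  linear_tmap3 tmap(1)[OF L] tmap_r(1)[OF L] tmap_l(1)[OF L] swap_map(1)[OF L] cycle_map(1)[OF L]

text \<open>
  \<open>tmap3\<close> is built from the bracketing \<open>L \<otimes> (L \<otimes> L)\<close>, while one side of Hom-coassociativity takes
  values in \<open>(L \<otimes> L) \<otimes> L\<close>.  Associativity \<open>f \<otimes> (g \<otimes> h) = (f \<otimes> g) \<otimes> h\<close> carries it over.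
\<close>

lemma tmap3_tens_l:
  assumes f: "lin11 f" and g: "lin11 g" and h: "lin11 h"
  shows "tmap3 L f (tmap L g h) (tens_l L w z) = tens_l L (tmap L f g w) (h z)"
proof -
  note gh = tmap(1)[OF L g h]
  have "tmap3 L f (tmap L g h) \<circ> (\<lambda>w. tens_l L w z) = (\<lambda>w. tens_l L w (h z)) \<circ> tmap L f g"
    by (rule tens2_eqI)
      ((rule linear_rules f g h)+,
        simp add: tens_assoc[symmetric] tmap3_tens_r[OF f gh] tmap(2)[OF L] f g h)
  then show ?thesis
    by (simp add: fun_eq_iff)
qed

lemma tmap_tmap:
  assumes "lin11 f" "lin11 g" "lin11 f'" "lin11 g'"
  shows "tmap L f g (tmap L f' g' w) = tmap L (f \<circ> f') (g \<circ> g') w"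
proof -
  have "tmap L f g \<circ> tmap L f' g' = tmap L (f \<circ> f') (g \<circ> g')"
    by (rule tens2_eqI)
      ((rule linear_rules assms)+,
        simp add: tmap(2)[OF L] linear_comp[OF assms(3,1)] linear_comp[OF assms(4,2)] assms)
  then show ?thesis
    by (metis o_apply)
qed

lemma tmap_swap:
  assumes "lin11 f" "lin11 g"
  shows "tmap L f g (swap_map L w) = swap_map L (tmap L g f w)"
proof -
  have "tmap L f g \<circ> swap_map L = swap_map L \<circ> tmap L g f"
    by (rule tens2_eqI)
      ((rule linear_rules assms)+,
        simp add: tmap(2)[OF L] swap_map(2)[OF L] assms)
  then show ?thesis
    by (simp add: fun_eq_iff)
qed

lemma swap_swap: "swap_map L (swap_map L w) = w"
proof -
  have "swap_map L \<circ> swap_map L = id"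
    by (rule tens2_eqI)
      ((rule linear_rules)+,
        simp add: swap_map(2)[OF L])
  then show ?thesis
    by (simp add: fun_eq_iff)
qed

lemma cycle_cycle_cycle: "cycle_map L (cycle_map L (cycle_map L w)) = w"
proof -
  have "cycle_map L \<circ> cycle_map L \<circ> cycle_map L = id"
    by (rule tens3_eqI)
      ((rule linear_rules)+,
        simp add: cycle_map(2)[OF L])
  then show ?thesis
    by (simp add: fun_eq_iff)
qed

lemma cycle_tens_r: "cycle_map L (tens_r L x w) = tens_l L w x"
proof -
  have "cycle_map L \<circ> tens_r L x = (\<lambda>w. tens_l L w x)"
    by (rule tens2_eqI)
      ((rule linear_rules)+,
        simp add: cycle_map(2)[OF L] tens_assoc[symmetric])
  then show ?thesis
    by (simp add: fun_eq_iff)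
qed

text \<open>In the symmetric group on three tensor factors, the transposition \<open>\<sigma> = 1 \<otimes> \<tau>\<close>
  conjugates the 3-cycle \<open>\<xi>\<close> to its inverse \<open>\<xi>\<^sup>2\<close>, that is \<open>\<sigma> \<xi>\<^sup>2 = \<xi> \<sigma>\<close>.\<close>

lemma swap3_cycle_cycle:
  "tmap3 L id (swap_map L) (cycle_map L (cycle_map L w))
    = cycle_map L (tmap3 L id (swap_map L) w)"
proof -
  have "tmap3 L id (swap_map L) \<circ> cycle_map L \<circ> cycle_map L
      = cycle_map L \<circ> tmap3 L id (swap_map L)"
    by (rule tens3_eqI)
      ((rule linear_rules)+,
        simp add: cycle_map(2)[OF L] tmap3_tens_r[OF linear_id swap_map(1)[OF L]] swap_map(2)[OF L])
  then show ?thesis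
    by (simp add: fun_eq_iff)
qed

section \<open>Twisting a Hom-AssCoDer pair by an idempotent endomorphism\<close>

text \<open>
  Both sides of Hom-coassociativity for \<open>P = (1 \<otimes> T) \<circ> \<Delta>\<close> are \<open>1 \<otimes> T \<otimes> T\<close> of the sides for \<open>\<Delta>\<close>: the
  side \<open>(\<alpha> \<otimes> P) \<circ> P\<close> by \<open>P \<circ> T = (T \<otimes> T) \<circ> \<Delta>\<close>, the side \<open>(P \<otimes> \<alpha>) \<circ> P\<close> by \<open>T \<circ> \<alpha> = \<alpha> \<circ> T\<close>.
  Moreover \<open>T\<close> commutes with \<open>\<delta>\<close> and \<open>\<alpha>\<close>, so \<open>1 \<otimes> T\<close> commutes with \<open>\<delta> \<otimes> \<alpha>\<close> and \<open>\<alpha> \<otimes> \<delta>\<close>, which gives the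
  coderivation property of the twisted coproduct.
\<close>

lemma hom_ass_coder_pair_twist:
  assumes pair: "hom_ass_coder_pair L \<Delta> \<delta> \<alpha>" and endo: "endomorphism_operator L \<Delta> \<alpha> T"
    and idem: "T \<circ> T = T" and T\<delta>: "T \<circ> \<delta> = \<delta> \<circ> T"
  shows "hom_ass_coder_pair L (\<lambda>x. tmap L id T (\<Delta> x)) \<delta> \<alpha>"
proof -
  have \<Delta>: "lin12 \<Delta>" and \<alpha>: "lin11 \<alpha>" and \<delta>: "lin11 \<delta>"
    and coass: "tmap_r L \<alpha> \<Delta> (\<Delta> x) = tmap_l L \<Delta> \<alpha> (\<Delta> x)"
    and coder: "\<Delta> (\<delta> x) = tmap L \<delta> \<alpha> (\<Delta> x) + tmap L \<alpha> \<delta> (\<Delta> x)" for x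
    using pair by (auto simp: hom_ass_coder_pair_def hom_coderivation_def fun_eq_iff)
  have T: "lin11 T" and \<Delta>T: "\<Delta> (T x) = tmap L T T (\<Delta> x)" and T\<alpha>: "T \<circ> \<alpha> = \<alpha> \<circ> T" for x
    using endo by (auto simp: endomorphism_operator_def fun_eq_iff)
  define P where "P = (\<lambda>x. tmap L id T (\<Delta> x))"
  note idT = tmap(1)[OF L linear_id T] and TT = tmap(1)[OF L T T]
  have P_apply: "P x = tmap L id T (\<Delta> x)" for x
    by (simp add: P_def)
  have P_comp: "P = tmap L id T \<circ> \<Delta>"
    by (simp add: P_def fun_eq_iff)
  have P: "lin12 P"
    unfolding P_comp by (rule linear_comp[OF \<Delta> idT])
  note T3 = tmap3[OF linear_id TT]
  \<comment> \<open>Here \<open>T\<^sup>2 = T\<close> enters: \<open>(1 \<otimes> T) \<circ> \<Delta> \<circ> T = (T \<otimes> T\<^sup>2) \<circ> \<Delta>\<close>.\<close>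
  have PT: "P (T x) = tmap L T T (\<Delta> x)" for x
    by (simp add: P_def \<Delta>T tmap_tmap linear_id T idem)
  have right: "tmap_r L \<alpha> P \<circ> tmap L id T = tmap3 L id (tmap L T T) \<circ> tmap_r L \<alpha> \<Delta>"
    by (rule tens2_eqI)
      ((rule linear_rules \<alpha> P \<Delta> T)+,
        simp add: tmap(2)[OF L linear_id T] tmap_r(2)[OF L \<alpha> P] tmap_r(2)[OF L \<alpha> \<Delta>] T3(2) PT)
  have left: "tmap_l L P \<alpha> \<circ> tmap L id T = tmap3 L id (tmap L T T) \<circ> tmap_l L \<Delta> \<alpha>"
    by (rule tens2_eqI)
      ((rule linear_rules \<alpha> P \<Delta> T)+,
        simp add: tmap(2)[OF L linear_id T] tmap_l(2)[OF L P \<alpha>] tmap_l(2)[OF L \<Delta> \<alpha>]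
          tmap3_tens_l[OF linear_id T T] P_apply fun_cong[OF T\<alpha>, unfolded o_apply])
  have "tmap_r L \<alpha> P (P x) = tmap_l L P \<alpha> (P x)" for x
    using fun_cong[OF right, of "\<Delta> x"] fun_cong[OF left, of "\<Delta> x"] coass[of x]
    by (simp add: P_apply)
  moreover have "P (\<delta> x) = tmap L \<delta> \<alpha> (P x) + tmap L \<alpha> \<delta> (P x)" for x
    by (simp add: P_def coder linear_apply_add[OF idT] tmap_tmap linear_id T \<alpha> \<delta> T\<alpha> T\<delta>)
  ultimately show ?thesis
    using P \<alpha> \<delta> by (simp add: hom_ass_coder_pair_def hom_coderivation_def fun_eq_iff P_def)
qed

section \<open>The cocommutator of a Hom-AssCoDer pair\<close>

lemma tmap_r_comp:
  assumes f: "lin11 f" and g: "lin12 g" and h: "lin22 h"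
  shows "tmap_r L f (h \<circ> g) w = tmap3 L id h (tmap_r L f g w)"
proof -
  have "tmap_r L f (h \<circ> g) = tmap3 L id h \<circ> tmap_r L f g"
    by (rule tens2_eqI)
      ((rule linear_rules f g h)+,
        simp add: tmap_r(2)[OF L f] g linear_comp[OF g h] tmap3_tens_r[OF linear_id h])
  then show ?thesis
    by simp
qed

lemma tmap_r_diff:
  assumes f: "lin11 f" and g: "lin12 g" and h: "lin12 h"
  shows "tmap_r L f (\<lambda>x. g x - h x) w = tmap_r L f g w - tmap_r L f h w"
proof -
  note gh = linear_minus[OF g h]
  have "tmap_r L f (\<lambda>x. g x - h x) = (\<lambda>w. tmap_r L f g w - tmap_r L f h w)"
    by (rule tens2_eqI)
      (rule tmap_r(1)[OF L f gh], rule linear_minus[OF tmap_r(1)[OF L f g] tmap_r(1)[OF L f h]],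
        simp add: tmap_r(2)[OF L f gh] tmap_r(2)[OF L f g] tmap_r(2)[OF L f h]
          linear_apply_diff[OF linear_tens_r])
  then show ?thesis
    by simp
qed

text \<open>Reversing the two factors before \<open>f \<otimes> g\<close> moves the block produced by \<open>g\<close> to the back; a rotation
  by \<open>\<xi>\<close> brings it to the front again, and \<open>\<xi>\<^sup>-\<^sup>1 = \<xi>\<^sup>2\<close>.\<close>

lemma tmap_r_swap:
  assumes f: "lin11 f" and g: "lin12 g"
  shows "tmap_r L f g (swap_map L w) = cycle_map L (cycle_map L (tmap_l L g f w))"
proof -
  have "cycle_map L \<circ> tmap_r L f g \<circ> swap_map L = tmap_l L g f"
    by (rule tens2_eqI)
      ((rule linear_rules f g)+,
        simp add: swap_map(2)[OF L] tmap_r(2)[OF L f g] tmap_l(2)[OF L g f] cycle_tens_r)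
  then have "cycle_map L (tmap_r L f g (swap_map L w)) = tmap_l L g f w"
    by (simp add: fun_eq_iff)
  then show ?thesis
    by (metis cycle_cycle_cycle)
qed

lemma hom_lie_coder_pair_cocommutator:
  assumes pair: "hom_ass_coder_pair L P \<delta> \<alpha>"
  shows "hom_lie_coder_pair L (\<lambda>x. P x - swap_map L (P x)) \<delta> \<alpha>"
proof -
  have P: "lin12 P" and \<alpha>: "lin11 \<alpha>" and \<delta>: "lin11 \<delta>"
    and coass: "tmap_r L \<alpha> P (P x) = tmap_l L P \<alpha> (P x)"
    and coder: "P (\<delta> x) = tmap L \<delta> \<alpha> (P x) + tmap L \<alpha> \<delta> (P x)" for x
    using pair by (auto simp: hom_ass_coder_pair_def hom_coderivation_def fun_eq_iff)
  note swap = swap_map(1)[OF L] and cyc = cycle_map(1)[OF L]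
  have sP: "lin12 (swap_map L \<circ> P)"
    by (rule linear_comp[OF P swap])
  define C where "C = (\<lambda>x. P x - swap_map L (P x))"
  have C_comp: "C = (\<lambda>x. P x - (swap_map L \<circ> P) x)"
    by (simp add: C_def)
  have C: "lin12 C"
    unfolding C_comp by (rule linear_minus[OF P sP])
  have skew: "C x = - swap_map L (C x)" for x
    by (simp add: C_def linear_apply_diff[OF swap] swap_swap)
  have jacobi: "w + cycle_map L w + cycle_map L (cycle_map L w) = 0"
    if w: "w = tmap_r L \<alpha> C (C x)" for w x
  proof -
    define A where "A = tmap_r L \<alpha> P (P x)"
    define S where "S = tmap3 L id (swap_map L)"
    have S: "lin33 S"
      unfolding S_def by (rule linear_tmap3[OF linear_id swap])
    have *: "tmap_r L \<alpha> C v = tmap_r L \<alpha> P v - S (tmap_r L \<alpha> P v)" for v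
      unfolding C_comp S_def tmap_r_diff[OF \<alpha> P sP] tmap_r_comp[OF \<alpha> P swap] ..
    have PsP: "tmap_r L \<alpha> P (swap_map L (P x)) = cycle_map L (cycle_map L A)"
      by (simp add: A_def coass tmap_r_swap[OF \<alpha> P])
    have "S (cycle_map L (cycle_map L A)) = cycle_map L (S A)"
      by (simp add: S_def swap3_cycle_cycle)
    \<comment> \<open>\<open>w\<close> is a difference of two elements of the form \<open>u - \<xi>\<^sup>2 u\<close> and \<open>u - \<xi> u\<close>; each of these is
      annihilated by \<open>1 + \<xi> + \<xi>\<^sup>2\<close>.\<close>
    then have "w = A - cycle_map L (cycle_map L A) - (S A - cycle_map L (S A))"
      unfolding w * C_def[THEN fun_cong] linear_apply_diff[OF tmap_r(1)[OF L \<alpha> P]]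
        linear_apply_diff[OF S] PsP
      by (simp add: A_def)
    then show ?thesis
      by (simp add: linear_apply_diff[OF cyc] cycle_cycle_cycle)
  qed
  have "C (\<delta> x) = tmap L \<delta> \<alpha> (C x) + tmap L \<alpha> \<delta> (C x)" for x
    by (simp add: C_def coder linear_apply_add[OF swap] tmap_swap \<alpha> \<delta>
        linear_apply_diff[OF tmap(1)[OF L]])
  then show ?thesis
    using C \<alpha> \<delta> skew jacobi
    unfolding hom_lie_coder_pair_def hom_coderivation_def C_def[symmetric] Let_def
    by blast
qed

end

theorem proposition4p6:
  fixes L :: "('k::field_char_0, 'l::ab_group_add, 'l2::ab_group_add, 'l3::ab_group_add) tensor_space"
    and \<Delta> :: "'l \<Rightarrow> 'l2" and \<delta> \<alpha> T :: "'l \<Rightarrow> 'l"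
  assumes "tensor_powers L"
    and "hom_ass_coder_pair L \<Delta> \<delta> \<alpha>"
    and "endomorphism_operator L \<Delta> \<alpha> T"
    and "T \<circ> T = T"
    and "T \<circ> \<delta> = \<delta> \<circ> T"
  shows "hom_lie_coder_pair L (commutator_coproduct L \<Delta> T) \<delta> \<alpha>"
proof -
  have T: "Vector_Spaces.linear (scale1 L) (scale1 L) T"
    using assms(3) by (simp add: endomorphism_operator_def)
  have "commutator_coproduct L \<Delta> T = (\<lambda>x. tmap L id T (\<Delta> x) - swap_map L (tmap L id T (\<Delta> x)))"
    by (simp add: fun_eq_iff commutator_coproduct_def
        tmap_swap[OF assms(1) T linear_id[OF assms(1)]])
  then show ?thesis
    using hom_lie_coder_pair_cocommutator[OF assms(1) hom_ass_coder_pair_twist[OF assms]] by simp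
qed

end
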